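(* Let $\mathbb K$ be the field of real or complex numbers, let $\mathcal X$ be a linear space over $\mathbb K$, and let $\mathcal N(\mathcal X)$ be the set of all norms on $\mathcal X$ together with the constant zero function $O$ on $\mathcal X$. Define, for $f,g\in\mathcal N(\mathcal X)$ and $\alpha\in\mathbb K$, $(f+g)(x):=f(x)+g(x)$ and $(\alpha f)(x):=|\alpha|f(x)$ for all $x\in\mathcal X$, and $f\le g$ if and only if $f(x)\le g(x)$ for all $x\in\mathcal X$. Then $\mathcal N(\mathcal X)$ is an exponential vector space over $\mathbb K$ with respect to these operations and this partial order.
   Context: An exponential vector space (evs) over a field $K$ is a partially ordered set $(X,\le)$ with a binary operation $+$ on $X$ and a scalar multiplication $\cdot:K\times X\to X$ satisfying: ($A_1$) $(X,+)$ is a commutative semigroup with identity $\theta$. ($A_2$) If $x\le y$ then $x+z\le y+z$ and $\alpha\cdot x\le\alpha\cdot y$ for all $z\in X$, $\alpha\in K$. ($A_3$) For all $x,y\in X$ and $\alpha,\beta\in K$: (i) $\alpha\cdot(x+y)=\alpha\cdot x+\alpha\cdot y$; (ii) $\alpha\cdot(\beta\cdot x)=(\alpha\beta)\cdot x$; (iii) $(\alpha+\beta)\cdot x\le\alpha\cdot x+\beta\cdot x$; (iv) $1\cdot x=x$. ($A_4$) $\alpha\cdot x=\theta$ if and only if $\alpha=0$ or $x=\theta$. ($A_5$) $x+(-1)\cdot x=\theta$ if and only if $x\in X_0$, where $X_0:=\{z\in X: y\not\le z\ \text{for all } y\in X\smallsetminus\{z\}\}$ is the set of minimal elements of $X$.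 ($A_6$) For each $x\in X$ there exists $p\in X_0$ with $p\le x$. *)

theory Defs
  imports Complex_Main
begin

definition minimal_elements :: "'x set \<Rightarrow> ('x \<Rightarrow> 'x \<Rightarrow> bool) \<Rightarrow> 'x set" where
  "minimal_elements X le = {z \<in> X. \<forall>y \<in> X - {z}. \<not> le y z}"

text \<open>
  An exponential vector space over the field \<open>'k\<close>, with carrier \<open>X\<close>, order \<open>le\<close>, addition \<open>add\<close>,
  additive identity \<open>\<theta>\<close> and scalar multiplication \<open>smult\<close>. The operations and the order are total
  functions on the ambient type, but every axiom is relativised to \<open>X\<close>.
\<close>

locale evs =
  fixes X :: "'x set"
    and le :: "'x \<Rightarrow> 'x \<Rightarrow> bool"
    and add :: "'x \<Rightarrow> 'x \<Rightarrow> 'x"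
    and \<theta> :: 'x
    and smult :: "'k::field \<Rightarrow> 'x \<Rightarrow> 'x"
  assumes le_refl: "reflp_on X le"
    and le_trans: "transp_on X le"
    and le_antisym: "antisymp_on X le"
    and add_closed: "\<lbrakk>x \<in> X; y \<in> X\<rbrakk> \<Longrightarrow> add x y \<in> X"
    and smult_closed: "x \<in> X \<Longrightarrow> smult \<alpha> x \<in> X"
    and A1_assoc: "\<lbrakk>x \<in> X; y \<in> X; z \<in> X\<rbrakk> \<Longrightarrow> add (add x y) z = add x (add y z)"
    and A1_commute: "\<lbrakk>x \<in> X; y \<in> X\<rbrakk> \<Longrightarrow> add x y = add y x"
    and A1_identity_closed: "\<theta> \<in> X"
    and A1_identity: "x \<in> X \<Longrightarrow> add \<theta> x = x"
    and A2_add: "\<lbrakk>x \<in> X; y \<in> X; z \<in> X; le x y\<rbrakk> \<Longrightarrow> le (add x z) (add y z)"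
    and A2_smult: "\<lbrakk>x \<in> X; y \<in> X; le x y\<rbrakk> \<Longrightarrow> le (smult \<alpha> x) (smult \<alpha> y)"
    and A3_i: "\<lbrakk>x \<in> X; y \<in> X\<rbrakk> \<Longrightarrow> smult \<alpha> (add x y) = add (smult \<alpha> x) (smult \<alpha> y)"
    and A3_ii: "x \<in> X \<Longrightarrow> smult \<alpha> (smult \<beta> x) = smult (\<alpha> * \<beta>) x"
    and A3_iii: "x \<in> X \<Longrightarrow> le (smult (\<alpha> + \<beta>) x) (add (smult \<alpha> x) (smult \<beta> x))"
    and A3_iv: "x \<in> X \<Longrightarrow> smult 1 x = x"
    and A4: "x \<in> X \<Longrightarrow> smult \<alpha> x = \<theta> \<longleftrightarrow> \<alpha> = 0 \<or> x = \<theta>"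
    and A5: "x \<in> X \<Longrightarrow> add x (smult (- 1) x) = \<theta> \<longleftrightarrow> x \<in> minimal_elements X le"
    and A6: "x \<in> X \<Longrightarrow> \<exists>p \<in> minimal_elements X le. le p x"

definition is_norm ::
  "('k::real_normed_field \<Rightarrow> 'a::ab_group_add \<Rightarrow> 'a) \<Rightarrow> ('a \<Rightarrow> real) \<Rightarrow> bool" where
  "is_norm scale f \<longleftrightarrow>
     (\<forall>x. 0 \<le> f x) \<and>
     (\<forall>x. f x = 0 \<longleftrightarrow> x = 0) \<and>
     (\<forall>\<alpha> x. f (scale \<alpha> x) = norm \<alpha> * f x) \<and>
     (\<forall>x y. f (x + y) \<le> f x + f y)"

definition zero_function :: "'a \<Rightarrow> real" where
  "zero_function = (\<lambda>x. 0)"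

definition norms_with_zero ::
  "('k::real_normed_field \<Rightarrow> 'a::ab_group_add \<Rightarrow> 'a) \<Rightarrow> ('a \<Rightarrow> real) set" where
  "norms_with_zero scale = {f. is_norm scale f} \<union> {zero_function}"

definition norm_add :: "('a \<Rightarrow> real) \<Rightarrow> ('a \<Rightarrow> real) \<Rightarrow> ('a \<Rightarrow> real)" where
  "norm_add f g = (\<lambda>x. f x + g x)"

definition norm_smult :: "'k::real_normed_field \<Rightarrow> ('a \<Rightarrow> real) \<Rightarrow> ('a \<Rightarrow> real)" where
  "norm_smult \<alpha> f = (\<lambda>x. norm \<alpha> * f x)"

definition norm_le :: "('a \<Rightarrow> real) \<Rightarrow> ('a \<Rightarrow> real) \<Rightarrow> bool" where
  "norm_le f g \<longleftrightarrow> (\<forall>x. f x \<le> g x)"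

end

theory Submission
  imports Defs
begin

text \<open>
  The order, the sum and the scaling of functions are all computed pointwise in \<open>\<real>\<close>, so the order
  axioms, \<open>A\<^sub>1\<close>, \<open>A\<^sub>2\<close> and \<open>A\<^sub>3\<close> are inherited from the arithmetic of nonnegative reals. Axiom
  \<open>A\<^sub>3\<close>(iii) is the triangle inequality \<open>\<bar>\<alpha> + \<beta>\<bar> \<le> \<bar>\<alpha>\<bar> + \<bar>\<beta>\<bar>\<close> multiplied by \<open>f x \<ge> 0\<close>.
  The set is closed under scaling because a norm times \<open>\<bar>\<alpha>\<bar>\<close> is again a norm when \<open>\<alpha> \<noteq> 0\<close>,
  and is \<open>O\<close> when \<open>\<alpha> = 0\<close>; so \<open>O\<close> is needed for scaling by \<open>0\<close> as well as for the identity.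
  Axiom \<open>A\<^sub>4\<close> holds because \<open>\<bar>\<alpha>\<bar> f x = 0\<close> for all \<open>x\<close> forces \<open>\<alpha> = 0\<close> or \<open>f = O\<close>.

  Axioms \<open>A\<^sub>5\<close> and \<open>A\<^sub>6\<close> rest on one observation: all the functions are nonnegative, so \<open>O\<close> is the least
  element and therefore the only minimal one (\<open>minimal_norms_with_zero\<close>). This gives \<open>A\<^sub>6\<close>, and it
  turns \<open>A\<^sub>5\<close> into the equivalence of \<open>f + \<bar>-1\<bar>f = 2f = O\<close> with \<open>f = O\<close>.

  The absolute value enters through being multiplicative, subadditive and definite, so the argument
  is carried out over an arbitrary normed field and then specialised to the real and the complex
  numbers.
\<close>

lemma norms_with_zero_nonneg:
  assumes "f \<in> norms_with_zero scale"
  shows "0 \<le> f x"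
  using assms by (auto simp: norms_with_zero_def zero_function_def is_norm_def)

lemma zero_function_in_norms_with_zero [simp]: "zero_function \<in> norms_with_zero scale"
  by (simp add: norms_with_zero_def)

lemma norm_add_zero_function [simp]:
  "norm_add zero_function f = f"
  "norm_add f zero_function = f"
  by (simp_all add: norm_add_def zero_function_def)

lemma is_norm_norm_add:
  assumes "is_norm scale f" "is_norm scale g"
  shows "is_norm scale (norm_add f g)"
proof -
  have "f (x + y) + g (x + y) \<le> f x + g x + (f y + g y)" for x y
  proof -
    have "f (x + y) \<le> f x + f y" "g (x + y) \<le> g x + g y"
      using assms by (auto simp: is_norm_def)
    then show ?thesis by linarith
  qed
  with assms show ?thesis
    by (auto simp: is_norm_def norm_add_def distrib_left add_nonneg_eq_0_iff)
qed

lemma is_norm_norm_smult: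
  assumes "is_norm scale f" "\<alpha> \<noteq> 0"
  shows "is_norm scale (norm_smult \<alpha> f)"
proof -
  have "norm \<alpha> * f (x + y) \<le> norm \<alpha> * f x + norm \<alpha> * f y" for x y
  proof -
    have "f (x + y) \<le> f x + f y"
      using assms by (simp add: is_norm_def)
    then have "norm \<alpha> * f (x + y) \<le> norm \<alpha> * (f x + f y)"
      by (rule mult_left_mono) simp
    then show ?thesis by (simp add: distrib_left)
  qed
  with assms show ?thesis
    by (auto simp: is_norm_def norm_smult_def mult.left_commute)
qed

lemma norm_add_closed:
  assumes "f \<in> norms_with_zero scale" "g \<in> norms_with_zero scale"
  shows "norm_add f g \<in> norms_with_zero scale"
  using assms by (auto simp: norms_with_zero_def is_norm_norm_add)

lemma norm_smult_eq_zero_function_iff: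
  "norm_smult \<alpha> f = zero_function \<longleftrightarrow> \<alpha> = 0 \<or> f = zero_function"
  by (auto simp: norm_smult_def zero_function_def fun_eq_iff)

lemma norm_smult_closed:
  assumes "f \<in> norms_with_zero scale"
  shows "norm_smult \<alpha> f \<in> norms_with_zero scale"
proof (cases "norm_smult \<alpha> f = zero_function")
  case False
  then have "\<alpha> \<noteq> 0" "f \<noteq> zero_function"
    by (simp_all add: norm_smult_eq_zero_function_iff)
  with assms show ?thesis
    by (auto simp: norms_with_zero_def is_norm_norm_smult)
qed simp

lemma zero_function_least:
  assumes "f \<in> norms_with_zero scale"
  shows "norm_le zero_function f"
  using norms_with_zero_nonneg[OF assms] by (simp add: norm_le_def zero_function_def)

lemma norm_le_antisym:
  assumes "norm_le f g" "norm_le g f"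
  shows "f = g"
  using assms by (auto simp: norm_le_def fun_eq_iff intro: antisym)

text \<open>
  In a partially ordered set with a least element, that element is the only minimal one.
\<close>
lemma minimal_norms_with_zero:
  "minimal_elements (norms_with_zero scale) norm_le = {zero_function}"
  by (auto simp: minimal_elements_def dest: zero_function_least norm_le_antisym)

text \<open>
  The function \<open>f + (-1)f\<close> is \<open>2f\<close> rather than \<open>O\<close>, because scaling by \<open>-1\<close> uses \<open>\<bar>-1\<bar> = 1\<close>.
\<close>
lemma norm_add_norm_smult_minus_one:
  "norm_add f (norm_smult (- 1) f) = zero_function \<longleftrightarrow> f = zero_function"
  by (auto simp: norm_add_def norm_smult_def zero_function_def fun_eq_iff)

theorem evs_norms_with_zero:
  fixes scale :: "'k::real_normed_field \<Rightarrow> 'a::ab_group_add \<Rightarrow> 'a"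
  shows "evs (norms_with_zero scale) norm_le norm_add zero_function
           (norm_smult :: 'k \<Rightarrow> ('a \<Rightarrow> real) \<Rightarrow> ('a \<Rightarrow> real))"
proof
  show "reflp_on (norms_with_zero scale) norm_le"
    by (simp add: reflp_on_def norm_le_def)
  show "transp_on (norms_with_zero scale) norm_le"
    by (auto simp: transp_on_def norm_le_def intro: order_trans)
  show "antisymp_on (norms_with_zero scale) norm_le"
    by (auto simp: antisymp_on_def intro: norm_le_antisym)
next
  fix f and \<alpha> \<beta> :: 'k
  assume f: "f \<in> norms_with_zero scale"
  have "norm (\<alpha> + \<beta>) * f x \<le> norm \<alpha> * f x + norm \<beta> * f x" for x
    using mult_right_mono[OF norm_triangle_ineq norms_with_zero_nonneg[OF f]]
    by (simp add: distrib_right)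
  then show "norm_le (norm_smult (\<alpha> + \<beta>) f) (norm_add (norm_smult \<alpha> f) (norm_smult \<beta> f))"
    by (simp add: norm_le_def norm_add_def norm_smult_def)
next
  fix f assume f: "f \<in> norms_with_zero scale"
  show "norm_add f (norm_smult (- 1 :: 'k) f) = zero_function
      \<longleftrightarrow> f \<in> minimal_elements (norms_with_zero scale) norm_le"
    by (simp add: norm_add_norm_smult_minus_one minimal_norms_with_zero)
  show "\<exists>p \<in> minimal_elements (norms_with_zero scale) norm_le. norm_le p f"
    using f by (simp add: minimal_norms_with_zero zero_function_least)
qed (simp_all add: norm_add_closed norm_smult_closed norm_smult_eq_zero_function_iff,
     simp_all add: norm_le_def norm_add_def norm_smult_def norm_mult
       algebra_simps mult_right_mono)

theorem theorem3p1:
  "(\<forall>scale :: real \<Rightarrow> 'a::ab_group_add \<Rightarrow> 'a. vector_space scale \<longrightarrow>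
      evs (norms_with_zero scale) norm_le norm_add zero_function
        (norm_smult :: real \<Rightarrow> ('a \<Rightarrow> real) \<Rightarrow> ('a \<Rightarrow> real))) \<and>
   (\<forall>scale :: complex \<Rightarrow> 'a \<Rightarrow> 'a. vector_space scale \<longrightarrow>
      evs (norms_with_zero scale) norm_le norm_add zero_function
        (norm_smult :: complex \<Rightarrow> ('a \<Rightarrow> real) \<Rightarrow> ('a \<Rightarrow> real)))"
  by (simp add: evs_norms_with_zero)

end
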